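(* Let $a,c\in\mathbb{C}$ with $|a|^2+|c|^2=1$, and let $g(z)=\dfrac{az-\bar c}{cz+\bar a}$, a Möbius map of $\mathbb{C}_\infty$. Let $S(z)=g(\bar z)$ and $S^*=p^{-1}Sp$, where $p:\mathbb{S}\to\mathbb{C}_\infty$ is the stereographic projection; $S^*$ is an indirect Euclidean isometry of the unit sphere $\mathbb{S}\subset\mathbb{R}^3$ onto itself. Then: (i) $S^*$ is a reflection if and only if $\operatorname{Re}(c)=0$; (ii) $S^*$ is a rotary reflection if and only if $\operatorname{Re}(c)\neq 0$.
   Context: $\mathbb{C}_\infty=\mathbb{C}\cup\{\infty\}$ is the Riemann sphere, and $p$ is the stereographic projection from $(0,0,1)$ of the unit sphere $\mathbb{S}$ in $\mathbb{R}^3$ onto $\mathbb{C}_\infty$ (with $\mathbb{C}$ identified with the horizontal coordinate plane and $p(0,0,1)=\infty$). By convention $\overline{\infty}=\infty$. An indirect Euclidean isometry of $\mathbb{S}$ is the restriction to $\mathbb{S}$ of a linear map given by a $3\times3$ real orthogonal matrix with determinant $-1$. Such a map is called a reflection if it is the (restriction to $\mathbb{S}$ of the) Euclidean reflection of $\mathbb{R}^3$ across a plane $\Pi$ through the origin. It is called a rotary reflection if it is the reflection across a plane $\Pi$ through the origin followed by a non-trivial rotation about the normal line to $\Pi$ through the origin. *)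

theory Defs
  imports "HOL-Analysis.Analysis"
begin

text \<open>The Riemann sphere: \<open>None\<close> is the point at infinity
  (the encoding also used by \<^const>\<open>Alexandroff_compactification\<close>).\<close>

type_synonym riemann_sphere = "complex option"

text \<open>Conjugation on the Riemann sphere is \<open>map_option cnj\<close>; it fixes infinity.\<close>

abbreviation ext_cnj :: "riemann_sphere \<Rightarrow> riemann_sphere" where
  "ext_cnj \<equiv> map_option cnj"

text \<open>The extension of \<open>z \<mapsto> (\<alpha> z + \<beta>) / (\<gamma> z + \<delta>)\<close> to the Riemann sphere
  (meaningful when \<open>\<alpha> \<delta> - \<beta> \<gamma> \<noteq> 0\<close>).\<close>

definition ext_moebius ::
    "complex \<Rightarrow> complex \<Rightarrow> complex \<Rightarrow> complex \<Rightarrow> riemann_sphere \<Rightarrow> riemann_sphere" where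
  "ext_moebius \<alpha> \<beta> \<gamma> \<delta> w =
     (case w of
        None \<Rightarrow> if \<gamma> = 0 then None else Some (\<alpha> / \<gamma>)
      | Some z \<Rightarrow> if \<gamma> * z + \<delta> = 0 then None else Some (moebius \<alpha> \<beta> \<gamma> \<delta> z))"

abbreviation unit_sphere :: "(real^3) set" where
  "unit_sphere \<equiv> sphere 0 1"

definition north_pole :: "real^3" where
  "north_pole = vector [0, 0, 1]"

text \<open>Stereographic projection: a point \<open>x \<noteq> north_pole\<close> of the sphere goes to the point where the
  line through \<open>north_pole\<close> and \<open>x\<close> meets the plane \<open>x$3 = 0\<close>. Only the values on the
  unit sphere are meaningful.\<close>

definition stereo :: "real^3 \<Rightarrow> riemann_sphere" where
  "stereo x =
     (if x = north_pole then None
      else Some (Complex (x$1 / (1 - x$3)) (x$2 / (1 - x$3))))"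

abbreviation stereo_inv :: "riemann_sphere \<Rightarrow> real^3" where
  "stereo_inv \<equiv> inv_into unit_sphere stereo"

text \<open>Only the values of \<open>sphere_map T\<close> on the unit sphere are meaningful; accordingly all
  predicates below look at a map on the unit sphere only.\<close>

definition sphere_map :: "(riemann_sphere \<Rightarrow> riemann_sphere) \<Rightarrow> real^3 \<Rightarrow> real^3" where
  "sphere_map T = stereo_inv \<circ> T \<circ> stereo"

definition indirect_isometry :: "(real^3 \<Rightarrow> real^3) \<Rightarrow> bool" where
  "indirect_isometry f \<longleftrightarrow>
     (\<exists>A :: real^3^3. orthogonal_matrix A \<and> det A = - 1 \<and> (\<forall>x\<in>unit_sphere. f x = A *v x))"

definition plane_through_origin :: "(real^3) set \<Rightarrow> bool" where
  "plane_through_origin P \<longleftrightarrow> subspace P \<and> dim P = 2"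

text \<open>The foot of the perpendicular from \<open>x\<close> to \<open>P\<close> is the midpoint of \<open>x\<close> and its mirror image.\<close>

definition reflection_across :: "(real^3) set \<Rightarrow> real^3 \<Rightarrow> real^3" where
  "reflection_across P x = 2 *\<^sub>R closest_point P x - x"

definition rotation_about :: "(real^3) set \<Rightarrow> (real^3 \<Rightarrow> real^3) \<Rightarrow> bool" where
  "rotation_about L R \<longleftrightarrow>
     orthogonal_transformation R \<and> det (matrix R) = 1 \<and> (\<forall>x\<in>L. R x = x)"

definition is_reflection :: "(real^3 \<Rightarrow> real^3) \<Rightarrow> bool" where
  "is_reflection f \<longleftrightarrow>
     (\<exists>P. plane_through_origin P \<and> (\<forall>x\<in>unit_sphere. f x = reflection_across P x))"

text \<open>The orthogonal complement of the plane \<open>P\<close> is its normal line through the origin.\<close>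

definition is_rotary_reflection :: "(real^3 \<Rightarrow> real^3) \<Rightarrow> bool" where
  "is_rotary_reflection f \<longleftrightarrow>
     (\<exists>P R. plane_through_origin P \<and> rotation_about (P\<^sup>\<bottom>) R \<and> R \<noteq> id \<and>
        (\<forall>x\<in>unit_sphere. f x = R (reflection_across P x)))"

lemma unit_sphere_iff: "x \<in> unit_sphere \<longleftrightarrow> (x$1)^2 + (x$2)^2 + (x$3)^2 = 1"
  by (simp add: norm_eq_1 inner_vec_def sum_3 power2_eq_square)

lemma third_eq_1_iff:
  assumes "x \<in> unit_sphere"
  shows "x$3 = 1 \<longleftrightarrow> x = north_pole"
  using assms unfolding unit_sphere_iff
  by (auto simp: north_pole_def vec_eq_iff forall_3 sum_power2_eq_zero_iff)

lemma stereo_bij: "bij_betw stereo unit_sphere UNIV"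
proof -
  define q :: "riemann_sphere \<Rightarrow> real^3" where
    "q w = (case w of None \<Rightarrow> north_pole
      | Some z \<Rightarrow> (1 / (1 + (cmod z)^2)) *\<^sub>R vector [2 * Re z, 2 * Im z, (cmod z)^2 - 1])" for w
  have pos: "1 + (Re z)^2 + (Im z)^2 > 0" for z
    by (smt (verit) zero_le_power2)
  have q_sphere: "q w \<in> unit_sphere" for w
  proof (cases w)
    case None
    then show ?thesis unfolding unit_sphere_iff by (simp add: q_def north_pole_def)
  next
    case (Some z)
    have "(2*u/(1+(u^2+t^2)))^2 + (2*t/(1+(u^2+t^2)))^2 + ((u^2+t^2-1)/(1+(u^2+t^2)))^2 = 1"
      for u t :: real
    proof -
      have "1+(u^2+t^2) \<noteq> 0" by (smt (verit) zero_le_power2)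
      moreover have "(2*u)^2 + (2*t)^2 + (u^2+t^2-1)^2 = (1+(u^2+t^2))^2"
        by (simp add: power2_eq_square algebra_simps)
      ultimately show ?thesis
        by (simp add: power_divide add_divide_distrib [symmetric])
    qed
    with Some show ?thesis
      unfolding unit_sphere_iff by (simp add: q_def cmod_power2)
  qed
  have pq: "stereo (q w) = w" for w
  proof (cases w)
    case None
    then show ?thesis by (simp add: stereo_def q_def)
  next
    case (Some z)
    define n where "n = (Re z)^2 + (Im z)^2"
    have n: "1 + n > 0" using pos [of z] by (simp add: n_def)
    have q: "q w $ 1 = 2 * Re z / (1+n)" "q w $ 2 = 2 * Im z / (1+n)" "q w $ 3 = (n-1)/(1+n)"
      using Some by (simp_all add: q_def cmod_power2 n_def)
    have d: "1 - q w $ 3 = 2 / (1+n)"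
      using n by (simp add: q field_simps)
    then have "q w \<noteq> north_pole"
      using n by (auto simp: north_pole_def)
    then show ?thesis
      using n Some unfolding stereo_def d q(1,2) by (simp add: complex_eq_iff)
  qed
  have qp: "q (stereo x) = x" if x: "x \<in> unit_sphere" for x
  proof (cases "x = north_pole")
    case True
    then show ?thesis by (simp add: stereo_def q_def)
  next
    case False
    define t where "t = 1 - x$3"
    have t: "t \<noteq> 0" using False third_eq_1_iff [OF x] by (simp add: t_def)
    have x3: "x$3 = 1 - t" by (simp add: t_def)
    have "(x$1)^2 + (x$2)^2 + (x$3)^2 = 1" using x unfolding unit_sphere_iff .
    then have e: "(x$1)^2 + (x$2)^2 = t * (2 - t)"
      by (simp add: x3 power2_eq_square algebra_simps)
    have c: "(cmod (Complex (x$1 / t) (x$2 / t)))^2 = (2 - t) / t"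
      using t e by (simp add: cmod_power2 power_divide add_divide_distrib [symmetric])
        (simp add: power2_eq_square)
    have s: "1 + (2 - t) / t = 2 / t" "(2 - t) / t - 1 = 2 * (1 - t) / t"
      using t by (simp_all add: field_simps)
    have "stereo x = Some (Complex (x$1 / t) (x$2 / t))"
      using False by (simp add: stereo_def t_def)
    then show ?thesis
      using t x3 by (simp add: q_def c s vec_eq_iff forall_3)
  qed
  show ?thesis
    by (rule bij_betw_byWitness [where f' = q]) (use q_sphere pq qp in blast)+
qed

lemma reflection_across_hyperplane:
  assumes "norm n = 1"
  shows "reflection_across {x. n \<bullet> x = 0} x = x - (2 * (n \<bullet> x)) *\<^sub>R n"
proof -
  let ?P = "{x. n \<bullet> x = 0}"
  let ?y = "x - (n \<bullet> x) *\<^sub>R n"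
  have nn: "n \<bullet> n = 1" using assms by (simp add: norm_eq_1)
  have y: "?y \<in> ?P" by (simp add: inner_diff_right nn)
  have "dist x ?y \<le> dist x z" if "z \<in> ?P" for z
  proof -
    have "\<bar>n \<bullet> x\<bar> = \<bar>n \<bullet> (x - z)\<bar>" using that by (simp add: inner_diff_right)
    also have "\<dots> \<le> norm n * norm (x - z)" by (rule Cauchy_Schwarz_ineq2)
    finally show ?thesis by (simp add: dist_norm assms)
  qed
  then have "?y = closest_point ?P x"
    by (intro closest_point_unique y convex_hyperplane closed_hyperplane ballI)
  then have "closest_point ?P x = ?y" ..
  then show ?thesis
    by (simp add: reflection_across_def scaleR_diff_right scaleR_2)
qed

lemma plane_through_origin_iff_hyperplane:
  "plane_through_origin P \<longleftrightarrow> (\<exists>n. norm n = 1 \<and> P = {x. n \<bullet> x = 0})"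
proof
  assume P: "plane_through_origin P"
  then have s: "subspace P" and d: "dim P = DIM(real^3) - 1"
    by (simp_all add: plane_through_origin_def)
  then obtain a where a: "a \<noteq> 0" "P = {x. a \<bullet> x = 0}"
    by (metis dim_eq_hyperplane span_eq_iff)
  then show "\<exists>n. norm n = 1 \<and> P = {x. n \<bullet> x = 0}"
    by (intro exI [of _ "a /\<^sub>R norm a"]) auto
next
  assume "\<exists>n. norm n = 1 \<and> P = {x. n \<bullet> x = 0}"
  then obtain n where n: "n \<noteq> 0" "P = {x. n \<bullet> x = 0}"
    by (metis norm_zero zero_neq_one)
  then show "plane_through_origin P"
    using dim_hyperplane [of n] by (simp add: plane_through_origin_def subspace_hyperplane)
qed

end

theory Submission
  imports Defs
begin

text \<open>
  A pair of complex numbers with \<open>\<bar>u\<bar>\<^sup>2 + \<bar>v\<bar>\<^sup>2 = 1\<close> is sent by the Hopf map to the point of the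
  sphere over \<open>u / v\<close>. In these homogeneous coordinates \<open>S\<close> acts by
  \<open>(u, v) \<mapsto> (a u\<^sup>* - c\<^sup>* v\<^sup>*, c u\<^sup>* + a\<^sup>* v\<^sup>*)\<close>, and as the Hopf map is quadratic this exhibits
  \<open>S\<^sup>*\<close> as an explicit matrix, which has determinant \<open>-1\<close> and trace \<open>1 - 4 (Re c)\<^sup>2\<close>.
  Every orthogonal \<open>A\<close> with determinant \<open>-1\<close> in dimension 3 reverses some unit vector \<open>n\<close>, hence is
  a rotation about \<open>n\<close> composed with the reflection in \<open>n\<close>; the rotation has trace
  \<open>trace A + 2\<close>, so it is trivial exactly when \<open>trace A = 1\<close>.
\<close>

section \<open>Indirect isometries of the sphere\<close>

text \<open>Columns of \<open>A\<close> are unit vectors, so each squared displacement of a basis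
  vector is \<open>2 * (1 - A$i$i)\<close>; these nonnegative numbers sum to zero.\<close>

lemma orthogonal_matrix_trace_eq_card:
  fixes A :: "real^'n^'n"
  assumes A: "orthogonal_matrix A" and tr: "trace A = CARD('n)"
  shows "A = mat 1"
proof -
  have ot: "orthogonal_transformation ((*v) A)"
    using A by (simp add: orthogonal_transformation_matrix)
  have *: "(norm (A *v axis i 1 - axis i 1))\<^sup>2 = 2 * (1 - A$i$i)" for i
  proof -
    have "(A *v axis i 1) \<bullet> (A *v axis i 1) = 1"
      using ot by (simp add: orthogonal_transformation_def inner_axis_axis)
    moreover have "(A *v axis i 1) \<bullet> axis i 1 = A$i$i"
      by (simp add: inner_axis matrix_vector_mult_basis column_def)
    ultimately show ?thesis
      by (simp add: power2_norm_eq_inner inner_diff inner_axis_axis inner_commute)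
  qed
  have "(\<Sum>i\<in>UNIV. (norm (A *v axis i 1 - axis i 1))\<^sup>2) = 0"
    using tr by (simp add: * trace_def sum_subtractf flip: sum_distrib_left)
  then have "A *v axis i 1 = axis i 1" for i
    by (simp add: sum_nonneg_eq_0_iff)
  then have "column i A = column i (mat 1)" for i
    by (metis matrix_vector_mul_lid matrix_vector_mult_basis)
  then show ?thesis
    by (simp add: column_def vec_eq_iff)
qed

text \<open>Taking determinants in \<open>A + 1 = A (1 + A)^T\<close> gives
  \<open>det (A + 1) = - det (A + 1)\<close>, so \<open>-1\<close> is an eigenvalue.\<close>

lemma orthogonal_matrix_reverses_unit_vector:
  fixes A :: "real^'n^'n"
  assumes A: "orthogonal_matrix A" and d: "det A = - 1"
  obtains n where "norm n = 1" "A *v n = - n"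
proof -
  have "A + mat 1 = A ** transpose (mat 1 + A)"
  proof -
    have "transpose (mat 1 + A) = mat 1 + transpose A"
      by (simp add: transpose_def mat_def vec_eq_iff)
    then show ?thesis
      using A by (simp add: matrix_add_ldistrib orthogonal_matrix_def)
  qed
  then have "det (A + mat 1) = - det (A + mat 1)"
    by (metis add.commute d det_mul det_transpose mult_minus1)
  then have "\<not> invertible (A + mat 1)"
    by (simp add: invertible_det_nz)
  then obtain x where x: "(A + mat 1) *v x = 0" "x \<noteq> 0"
    by (metis invertible_left_inverse matrix_left_invertible_ker)
  then have "A *v x = - x"
    by (simp add: matrix_vector_mult_add_rdistrib eq_neg_iff_add_eq_0)
  with x(2) show thesis
    by (intro that [of "x /\<^sub>R norm x"]) (simp_all add: matrix_vector_mult_scaleR)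
qed

section \<open>Hyperplane reflections in explicit form\<close>

definition householder :: "real^'n \<Rightarrow> real^'n \<Rightarrow> real^'n" where
  "householder n x = x - (2 * (n \<bullet> x)) *\<^sub>R n"

lemma householder_self: "norm n = 1 \<Longrightarrow> householder n n = - n"
  by (simp add: householder_def norm_eq_1 scaleR_2)

lemma householder_involution:
  assumes "norm n = 1"
  shows "householder n (householder n x) = x"
proof -
  have "n \<bullet> householder n x = - (n \<bullet> x)"
    using assms by (simp add: householder_def norm_eq_1 inner_diff_right)
  then show ?thesis
    by (simp add: householder_def [of n "householder n x"]) (simp add: householder_def)
qed

lemma linear_householder: "linear (householder n)"
  unfolding householder_def
  by (rule linearI) (simp_all add: inner_add_right algebra_simps)

lemma orthogonal_transformation_householder:
  assumes "norm n = 1"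
  shows "orthogonal_transformation (householder n)"
  using assms
  by (simp add: orthogonal_transformation_def linear_householder)
    (simp add: householder_def norm_eq_1 inner_diff_left inner_diff_right inner_commute)

lemma det_householder:
  fixes n :: "real^3"
  assumes "norm n = 1"
  shows "det (matrix (householder n)) = - 1"
proof -
  have "n \<bullet> n = 1" using assms by (simp add: norm_eq_1)
  then have "(n$1)^2 + (n$2)^2 + (n$3)^2 = 1"
    by (simp add: inner_vec_def sum_3 power2_eq_square)
  \<comment> \<open>The left-hand side is the expanded determinant of
    \<open>1 - 2 n n^T\<close>.\<close>
  then have "1 - 2 * ((n$1)^2 + (n$2)^2 + (n$3)^2) = -1" by simp
  then show ?thesis
    by (simp add: det_3 matrix_def householder_def inner_axis)
      (simp add: axis_def power2_eq_square algebra_simps)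
qed

text \<open>Here \<open>A (1 - 2 n n^T) = A - 2 (A n) n^T\<close>, and \<open>(A n) n^T\<close> has
  trace \<open>n \<bullet> (A *v n)\<close>.\<close>

lemma trace_mult_householder:
  fixes A :: "real^'n^'n"
  shows "trace (A ** matrix (householder n)) = trace A - 2 * (n \<bullet> (A *v n))"
proof -
  have "(A ** matrix (householder n)) $ i $ i = A$i$i - 2 * (n$i * (A *v n)$i)" for i
  proof -
    have "(A ** matrix (householder n)) $ i $ i = (A *v householder n (axis i 1)) $ i"
      by (simp add: matrix_matrix_mult_def matrix_vector_mult_def matrix_def)
    then show ?thesis
      by (simp add: householder_def inner_axis matrix_vector_mult_diff_distrib
          matrix_vector_mult_scaleR matrix_vector_mult_basis column_def)
  qed
  then show ?thesis
    by (simp add: trace_def inner_vec_def sum_subtractf sum_distrib_left)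
qed

lemma linear_eq_on_sphere:
  fixes f g :: "'a::real_normed_vector \<Rightarrow> 'b::real_vector"
  assumes "linear f" "linear g" and eq: "\<And>x. x \<in> sphere 0 1 \<Longrightarrow> f x = g x"
  shows "f = g"
proof
  fix x
  show "f x = g x"
  proof (cases "x = 0")
    case False
    then have "f (x /\<^sub>R norm x) = g (x /\<^sub>R norm x)" by (intro eq) simp
    then show ?thesis
      using False assms(1,2) by (simp add: linear_scale)
  qed (simp add: assms linear_0)
qed

section \<open>Characterizing reflections and rotary reflections\<close>

lemma is_reflection_iff_householder:
  "is_reflection f \<longleftrightarrow> (\<exists>n. norm n = 1 \<and> (\<forall>x\<in>unit_sphere. f x = householder n x))"
  unfolding is_reflection_def plane_through_origin_iff_hyperplane
  by (metis householder_def reflection_across_hyperplane)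

lemma orthogonal_comp_hyperplane: "{x. n \<bullet> x = 0}\<^sup>\<bottom> = range (\<lambda>t. t *\<^sub>R n)"
  for n :: "'a::euclidean_space"
proof -
  have "{x. n \<bullet> x = 0} = (span {n})\<^sup>\<bottom>"
    by (auto simp: orthogonal_comp_def orthogonal_def span_singleton)
  then show ?thesis
    by (simp add: orthogonal_comp_self) (simp add: span_singleton)
qed

lemma is_rotary_reflection_iff_householder:
  "is_rotary_reflection f \<longleftrightarrow>
     (\<exists>n R. norm n = 1 \<and> orthogonal_transformation R \<and> det (matrix R) = 1 \<and> R n = n \<and> R \<noteq> id \<and>
        (\<forall>x\<in>unit_sphere. f x = R (householder n x)))"
  (is "_ \<longleftrightarrow> ?rhs")
proof -
  \<comment> \<open>By linearity, fixing the whole normal line amounts to fixing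
    \<open>n\<close>.\<close>
  have "rotation_about ({x. n \<bullet> x = 0}\<^sup>\<bottom>) R \<longleftrightarrow>
      orthogonal_transformation R \<and> det (matrix R) = 1 \<and> R n = n" for R n
    unfolding rotation_about_def orthogonal_comp_hyperplane
    by (auto simp: orthogonal_transformation_scaleR)
  then have "?rhs \<longleftrightarrow> (\<exists>n R. norm n = 1 \<and> rotation_about ({x. n \<bullet> x = 0}\<^sup>\<bottom>) R \<and> R \<noteq> id \<and>
      (\<forall>x\<in>unit_sphere. f x = R (reflection_across {x. n \<bullet> x = 0} x)))"
    by (simp add: reflection_across_hyperplane householder_def cong: conj_cong)
  also have "\<dots> \<longleftrightarrow> is_rotary_reflection f"
    unfolding is_rotary_reflection_def plane_through_origin_iff_hyperplane by blast
  finally show ?thesis ..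
qed

lemma is_reflection_iff_trace:
  assumes A: "orthogonal_matrix A" and d: "det A = - 1"
    and f: "\<And>x. x \<in> unit_sphere \<Longrightarrow> f x = A *v x"
  shows "is_reflection f \<longleftrightarrow> trace A = 1"
proof
  assume "is_reflection f"
  then obtain n where n: "norm n = 1" and "\<And>x. x \<in> unit_sphere \<Longrightarrow> A *v x = householder n x"
    using f unfolding is_reflection_iff_householder by metis
  then have "(*v) A = householder n"
    by (intro linear_eq_on_sphere linear_householder matrix_vector_mul_linear)
  then have "A = matrix (householder n)"
    by (metis matrix_of_matrix_vector_mul)
  \<comment> \<open>The identity factor lets the product formula apply: the trace is
    \<open>3 - 2\<close>.\<close>
  then have "trace A = trace (mat 1 ** matrix (householder n))" by simp
  also have "\<dots> = 1"
    using n by (simp add: trace_mult_householder trace_I norm_eq_1 del: matrix_mul_lid)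
  finally show "trace A = 1" .
next
  assume tr: "trace A = 1"
  obtain n where n: "norm n = 1" "A *v n = - n"
    using orthogonal_matrix_reverses_unit_vector [OF A d] .
  \<comment> \<open>Since \<open>A\<close> reverses \<open>n\<close>, the product formula adds 2 to
    the trace of \<open>A\<close>.\<close>
  have "trace (A ** matrix (householder n)) = 3"
    using n tr by (simp add: trace_mult_householder norm_eq_1)
  moreover have "orthogonal_matrix (A ** matrix (householder n))"
    using A n orthogonal_transformation_householder orthogonal_matrix_mul
      orthogonal_transformation_matrix by blast
  ultimately have "A ** matrix (householder n) = mat 1"
    by (intro orthogonal_matrix_trace_eq_card) simp_all
  then have "A *v householder n x = x" for x
    by (metis matrix_vector_mul(2) [OF linear_householder] matrix_vector_mul_assoc
        matrix_vector_mul_lid)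
  then have "A *v x = householder n x" for x
    by (metis householder_involution n(1))
  then show "is_reflection f"
    using f n unfolding is_reflection_iff_householder by auto
qed

text \<open>A rotary reflection reverses the normal \<open>n\<close> of its plane. If it were also a
  reflection, its mirror would have to be that plane, forcing the rotation to be trivial.
  Conversely, a reversed vector supplies the plane.\<close>

lemma is_rotary_reflection_iff_not_reflection:
  assumes "indirect_isometry f"
  shows "is_rotary_reflection f \<longleftrightarrow> \<not> is_reflection f"
proof
  assume "is_rotary_reflection f"
  then obtain n R where n: "norm n = 1" and R: "orthogonal_transformation R" "R n = n" "R \<noteq> id"
    and f: "\<And>x. x \<in> unit_sphere \<Longrightarrow> f x = R (householder n x)"
    unfolding is_rotary_reflection_iff_householder by blast
  show "\<not> is_reflection f"
  proof
    assume "is_reflection f"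
    then obtain m where m: "norm m = 1" and fm: "\<And>x. x \<in> unit_sphere \<Longrightarrow> f x = householder m x"
      unfolding is_reflection_iff_householder by blast
    have "householder m n = R (householder n n)"
      using f fm n by simp
    also have "\<dots> = - n"
      using R n by (simp add: householder_self orthogonal_transformation_linear linear_neg)
    \<comment> \<open>Only multiples of \<open>m\<close> are reversed by the reflection with normal
      \<open>m\<close>.\<close>
    finally have "2 *\<^sub>R n = 2 *\<^sub>R ((m \<bullet> n) *\<^sub>R m)"
      by (simp add: householder_def scaleR_2 algebra_simps)
    then have "n = (m \<bullet> n) *\<^sub>R m"
      by (subst (asm) scaleR_cancel_left) simp
    moreover from this have "(m \<bullet> n)\<^sup>2 = 1"
      by (metis m n norm_scaleR mult.right_neutral power2_abs power_one)
    \<comment> \<open>The normal enters quadratically, so its sign is irrelevant.\<close>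
    moreover have "householder (t *\<^sub>R m) x = householder m x" if "t\<^sup>2 = 1" for t x
      using that by (simp add: householder_def power2_eq_square mult.left_commute)
    ultimately have "householder n x = householder m x" for x
      by metis
    then have "R (householder n x) = householder n x" if "x \<in> unit_sphere" for x
      using f fm that by simp
    then have "R \<circ> householder n = householder n"
      using R by (intro linear_eq_on_sphere linear_householder linear_compose)
        (auto simp: orthogonal_transformation_linear)
    then have "R x = x" for x
      by (metis comp_apply householder_involution n)
    with R show False by (auto simp: id_def)
  qed
next
  assume nr: "\<not> is_reflection f"
  obtain A where A: "orthogonal_matrix A" "det A = - 1" and f: "\<And>x. x \<in> unit_sphere \<Longrightarrow> f x = A *v x"
    using assms unfolding indirect_isometry_def by blast
  obtain n where n: "norm n = 1" "A *v n = - n"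
    using orthogonal_matrix_reverses_unit_vector [OF A] .
  \<comment> \<open>As \<open>householder n\<close> is an involution,
    \<open>A = R \<circ> householder n\<close> forces this choice.\<close>
  define R where "R x = A *v householder n x" for x
  have R_comp: "R = (*v) A \<circ> householder n"
    by (auto simp: R_def)
  have Rh: "R (householder n x) = A *v x" for x
    using n by (simp add: R_def householder_involution)
  have "orthogonal_transformation R"
    unfolding R_comp using A n
    by (intro orthogonal_transformation_compose orthogonal_transformation_householder)
      (simp_all add: orthogonal_transformation_matrix)
  moreover have "det (matrix R) = 1"
    using A n by (simp add: R_comp matrix_compose linear_householder det_mul det_householder)
  moreover have "R n = n"
    using n by (simp add: R_def householder_self vec.neg)
  moreover have "R \<noteq> id"
  proof
    assume "R = id"
    then have "f x = householder n x" if "x \<in> unit_sphere" for x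
      using f [OF that] Rh [of x] by simp
    with n nr show False
      unfolding is_reflection_iff_householder by blast
  qed
  ultimately show "is_rotary_reflection f"
    unfolding is_rotary_reflection_iff_householder
    by (intro exI [of _ n] exI [of _ R]) (simp add: f n Rh)
qed

section \<open>Homogeneous coordinates\<close>

definition hopf :: "complex \<Rightarrow> complex \<Rightarrow> real^3" where
  "hopf u v = vector [2 * Re (u * cnj v), 2 * Im (u * cnj v), (cmod u)\<^sup>2 - (cmod v)\<^sup>2]"

definition proj_ratio :: "complex \<Rightarrow> complex \<Rightarrow> riemann_sphere" where
  "proj_ratio u v = (if v = 0 then None else Some (u / v))"

text \<open>This is the identity
  \<open>4 |u v|^2 + (|u|^2 - |v|^2)^2 = (|u|^2 + |v|^2)^2\<close>.\<close>

lemma hopf_in_sphere: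
  assumes "(cmod u)\<^sup>2 + (cmod v)\<^sup>2 = 1"
  shows "hopf u v \<in> unit_sphere"
proof -
  have "(2 * Re (u * cnj v))\<^sup>2 + (2 * Im (u * cnj v))\<^sup>2 + ((cmod u)\<^sup>2 - (cmod v)\<^sup>2)\<^sup>2
      = ((cmod u)\<^sup>2 + (cmod v)\<^sup>2)\<^sup>2"
    unfolding cmod_power2 by (simp add: power2_eq_square algebra_simps)
  then show ?thesis
    unfolding unit_sphere_iff hopf_def using assms by simp
qed

text \<open>Normalization makes the denominator \<open>1 - x$3\<close> equal to
  \<open>2 |v|^2\<close>, which turns the projection into
  \<open>u v\<^sup>* / |v|^2 = u / v\<close>; it vanishes exactly over infinity.\<close>

lemma stereo_hopf:
  assumes 1: "(cmod u)\<^sup>2 + (cmod v)\<^sup>2 = 1"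
  shows "stereo (hopf u v) = proj_ratio u v"
proof -
  have d: "1 - hopf u v $ 3 = 2 * (cmod v)\<^sup>2"
    using 1 by (simp add: hopf_def)
  have np: "hopf u v = north_pole \<longleftrightarrow> v = 0"
    using d third_eq_1_iff [OF hopf_in_sphere [OF 1]] by auto
  show ?thesis
  proof (cases "v = 0")
    case False
    have "u / v = (u * cnj v) / of_real ((cmod v)\<^sup>2)"
      by (rule complex_div_cnj)
    also have "\<dots> = Complex (Re (u * cnj v) / (cmod v)\<^sup>2) (Im (u * cnj v) / (cmod v)\<^sup>2)"
      by (simp only: complex_eq_iff Re_divide_of_real Im_divide_of_real complex.sel)
    also have "\<dots> = Complex (hopf u v $ 1 / (1 - hopf u v $ 3)) (hopf u v $ 2 / (1 - hopf u v $ 3))"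
      unfolding d by (simp add: hopf_def del: times_complex.sel)
    finally show ?thesis
      using False np by (simp add: stereo_def proj_ratio_def)
  qed (use np in \<open>simp add: stereo_def proj_ratio_def\<close>)
qed

lemma stereo_inv_proj_ratio:
  assumes "(cmod u)\<^sup>2 + (cmod v)\<^sup>2 = 1"
  shows "stereo_inv (proj_ratio u v) = hopf u v"
  using inv_into_f_f [OF bij_betw_imp_inj_on [OF stereo_bij] hopf_in_sphere [OF assms]]
  by (simp add: stereo_hopf assms)

lemma hopf_surj:
  assumes "x \<in> unit_sphere"
  obtains u v where "(cmod u)\<^sup>2 + (cmod v)\<^sup>2 = 1" "x = hopf u v"
proof -
  obtain u v where uv: "(cmod u)\<^sup>2 + (cmod v)\<^sup>2 = 1" "stereo x = proj_ratio u v"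
  proof (cases "stereo x")
    case None
    show ?thesis
      by (rule that [of 1 0]) (simp_all add: None proj_ratio_def)
  next
    case (Some z)
    \<comment> \<open>The length of the representative \<open>(z, 1)\<close>.\<close>
    define s where "s = sqrt (1 + (cmod z)\<^sup>2)"
    have s: "s > 0" "s\<^sup>2 = 1 + (cmod z)\<^sup>2"
      by (simp_all add: s_def add_pos_nonneg)
    show ?thesis
    proof (rule that [of "z / of_real s" "1 / of_real s"])
      show "(cmod (z / of_real s))\<^sup>2 + (cmod (1 / of_real s))\<^sup>2 = 1"
        using s(1) by (simp add: norm_divide power_divide add.commute flip: add_divide_distrib s(2))
    qed (use s(1) in \<open>simp add: Some proj_ratio_def\<close>)
  qed
  have "x = stereo_inv (stereo x)"
    using inv_into_f_f [OF bij_betw_imp_inj_on [OF stereo_bij] assms] by simp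
  with uv show thesis
    using that by (simp add: stereo_inv_proj_ratio)
qed

section \<open>The action of \<open>S\<close> in homogeneous coordinates\<close>

lemma ext_cnj_proj_ratio: "ext_cnj (proj_ratio u v) = proj_ratio (cnj u) (cnj v)"
  by (simp add: proj_ratio_def)

lemma ext_moebius_proj_ratio:
  assumes "u \<noteq> 0 \<or> v \<noteq> 0"
  shows "ext_moebius \<alpha> \<beta> \<gamma> \<delta> (proj_ratio u v) = proj_ratio (\<alpha> * u + \<beta> * v) (\<gamma> * u + \<delta> * v)"
proof (cases "v = 0")
  case True
  with assms show ?thesis by (auto simp: ext_moebius_def proj_ratio_def)
next
  case False
  then have "\<gamma> * (u / v) + \<delta> = (\<gamma> * u + \<delta> * v) / v" "\<alpha> * (u / v) + \<beta> = (\<alpha> * u + \<beta> * v) / v"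
    by (simp_all add: field_simps)
  with False show ?thesis by (simp add: ext_moebius_def proj_ratio_def moebius_def)
qed

lemma sphere_map_hopf:
  assumes ac: "(cmod a)\<^sup>2 + (cmod c)\<^sup>2 = 1" and uv: "(cmod u)\<^sup>2 + (cmod v)\<^sup>2 = 1"
  defines "u' \<equiv> a * cnj u - cnj c * cnj v" and "v' \<equiv> c * cnj u + cnj a * cnj v"
  shows "(cmod u')\<^sup>2 + (cmod v')\<^sup>2 = 1"
    and "sphere_map (\<lambda>z. ext_moebius a (- cnj c) c (cnj a) (ext_cnj z)) (hopf u v) = hopf u' v'"
proof -
  \<comment> \<open>The coefficient matrix with rows \<open>(a, - cnj c)\<close> and
    \<open>(c, cnj a)\<close> is a scalar multiple of a unitary one.\<close>
  have "(cmod u')\<^sup>2 + (cmod v')\<^sup>2 = ((cmod a)\<^sup>2 + (cmod c)\<^sup>2) * ((cmod u)\<^sup>2 + (cmod v)\<^sup>2)"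
    unfolding cmod_power2 u'_def v'_def by (simp add: power2_eq_square algebra_simps)
  with ac uv show 1: "(cmod u')\<^sup>2 + (cmod v')\<^sup>2 = 1" by simp
  have "cnj u \<noteq> 0 \<or> cnj v \<noteq> 0" using uv by auto
  then show "sphere_map (\<lambda>z. ext_moebius a (- cnj c) c (cnj a) (ext_cnj z)) (hopf u v) = hopf u' v'"
    using stereo_inv_proj_ratio [OF 1] uv
    by (simp add: sphere_map_def stereo_hopf ext_cnj_proj_ratio ext_moebius_proj_ratio
        u'_def v'_def)
qed

text \<open>The columns are read off from
  \<open>2 u' v'\<^sup>* = a\<^sup>2 (2 u v\<^sup>*)\<^sup>* - (c\<^sup>*)\<^sup>2 (2 u v\<^sup>*) + 2 a c\<^sup>* (\<bar>u\<bar>\<^sup>2 - \<bar>v\<bar>\<^sup>2)\<close> and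
  \<open>\<bar>u'\<bar>\<^sup>2 - \<bar>v'\<bar>\<^sup>2 = (\<bar>a\<bar>\<^sup>2 - \<bar>c\<bar>\<^sup>2) (\<bar>u\<bar>\<^sup>2 - \<bar>v\<bar>\<^sup>2) - 2 Re (a c (2 u v\<^sup>*)\<^sup>*)\<close>,
  where \<open>(u', v')\<close> is the image of \<open>(u, v)\<close>.\<close>

definition isometry_matrix :: "complex \<Rightarrow> complex \<Rightarrow> real^3^3" where
  "isometry_matrix a c = vector
    [vector [Re (a\<^sup>2) - Re (c\<^sup>2), Im (a\<^sup>2) - Im (c\<^sup>2), 2 * Re (a * cnj c)],
     vector [Im (a\<^sup>2) + Im (c\<^sup>2), - Re (a\<^sup>2) - Re (c\<^sup>2), 2 * Im (a * cnj c)],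
     vector [- 2 * Re (a * c), - 2 * Im (a * c), (cmod a)\<^sup>2 - (cmod c)\<^sup>2]]"

lemma isometry_matrix_hopf:
  "isometry_matrix a c *v hopf u v
    = hopf (a * cnj u - cnj c * cnj v) (c * cnj u + cnj a * cnj v)"
  unfolding isometry_matrix_def hopf_def cmod_power2
  by (simp add: vec_eq_iff forall_3 matrix_vector_mult_def sum_3 power2_eq_square algebra_simps)

text \<open>The matrix scales lengths by \<open>|a|^2 + |c|^2\<close> and reverses orientation in
  dimension 3, whence the cube and the sign.\<close>

lemma det_isometry_matrix:
  "det (isometry_matrix a c) = - (((cmod a)\<^sup>2 + (cmod c)\<^sup>2) ^ 3)"
  unfolding isometry_matrix_def cmod_power2
  by (simp add: det_3 power2_eq_square power3_eq_cube algebra_simps)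

text \<open>On the diagonal \<open>Re (a\<^sup>2)\<close> cancels; with
  \<open>|a|^2 = 1 - |c|^2\<close> there remains
  \<open>1 - 2 (Re (c\<^sup>2) + |c|^2)\<close>.\<close>

lemma trace_isometry_matrix:
  assumes "(cmod a)\<^sup>2 + (cmod c)\<^sup>2 = 1"
  shows "trace (isometry_matrix a c) = 1 - 4 * (Re c)\<^sup>2"
  using assms unfolding isometry_matrix_def cmod_power2
  by (simp add: trace_def sum_3 power2_eq_square algebra_simps)

theorem theorem3p2:
  fixes a c :: complex and g S :: "riemann_sphere \<Rightarrow> riemann_sphere" and Sstar :: "real^3 \<Rightarrow> real^3"
  assumes "(cmod a)\<^sup>2 + (cmod c)\<^sup>2 = 1"
    and "g = ext_moebius a (- cnj c) c (cnj a)"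
    and "S = (\<lambda>z. g (ext_cnj z))"
    and "Sstar = sphere_map S"
  shows "indirect_isometry Sstar \<and> Sstar ` unit_sphere = unit_sphere
    \<and> (is_reflection Sstar \<longleftrightarrow> Re c = 0)
    \<and> (is_rotary_reflection Sstar \<longleftrightarrow> Re c \<noteq> 0)"
proof -
  let ?A = "isometry_matrix a c"
  have f: "Sstar x = ?A *v x" and norm_A: "norm (?A *v x) = 1" if x: "x \<in> unit_sphere" for x
  proof -
    obtain u v where uv: "(cmod u)\<^sup>2 + (cmod v)\<^sup>2 = 1" "x = hopf u v"
      using hopf_surj [OF x] by metis
    show "Sstar x = ?A *v x"
      by (simp add: assms(2-4) uv(2) sphere_map_hopf(2) [OF assms(1) uv(1)] isometry_matrix_hopf)
    show "norm (?A *v x) = 1"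
      using hopf_in_sphere [OF sphere_map_hopf(1) [OF assms(1) uv(1)]]
      by (simp add: uv(2) isometry_matrix_hopf)
  qed
  \<comment> \<open>Orthogonality follows from preservation of length, extended from the sphere by
    homogeneity, without multiplying out \<open>?A\<close> and its transpose.\<close>
  have "norm (?A *v x) = norm x" for x
  proof (cases "x = 0")
    case False
    then show ?thesis
      using norm_A [of "x /\<^sub>R norm x"] by (simp add: matrix_vector_mult_scaleR field_simps)
  qed simp
  then have ot: "orthogonal_transformation ((*v) ?A)"
    by (simp add: orthogonal_transformation)
  then have A: "orthogonal_matrix ?A"
    by (simp add: orthogonal_transformation_matrix)
  have d: "det ?A = - 1"
    by (simp add: det_isometry_matrix assms(1))
  have indirect: "indirect_isometry Sstar"
    using A d f unfolding indirect_isometry_def by blast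
  moreover have "Sstar ` unit_sphere = unit_sphere"
  proof -
    have "Sstar ` unit_sphere = (*v) ?A ` unit_sphere"
      using f by (intro image_cong) simp_all
    also have "\<dots> = unit_sphere"
    proof
      show "unit_sphere \<subseteq> (*v) ?A ` unit_sphere"
      proof
        fix y assume "y \<in> unit_sphere"
        moreover obtain x where "y = ?A *v x"
          using orthogonal_transformation_surj [OF ot] by (meson surjD)
        ultimately show "y \<in> (*v) ?A ` unit_sphere"
          using orthogonal_transformation_norm [OF ot] by auto
      qed
    qed (use norm_A in auto)
    finally show ?thesis .
  qed
  moreover have "is_reflection Sstar \<longleftrightarrow> Re c = 0"
    using is_reflection_iff_trace [OF A d f] by (simp add: trace_isometry_matrix assms(1))
  ultimately show ?thesis
    using is_rotary_reflection_iff_not_reflection by blast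
qed

end
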